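(* Let $\gamma:\mathbb{S}^1\to\mathbb{R}^2$ be an $\ell$-convex Legendre curve with algebraic length $L$ and algebraic area $A$. Then for every real $\tau\le 8$, $$\int_0^{2\pi}\beta^2(\theta)\,d\theta\ \ge\ 2A+\tau\left(\frac{L^2}{4\pi}-A\right),$$ and equality holds if $\gamma$ is a circle. Moreover, for any $\tau<8$, if equality holds then $\gamma$ is a circle; and for $\tau=8$, if equality holds then the support function of $\gamma$ is of the form $$p(\theta)=a_0+a_1\cos\theta+b_1\sin\theta+a_2\cos2\theta+b_2\sin2\theta$$ for some real constants $a_0,a_1,b_1,a_2,b_2$.
   Context: $\mathbb{S}^1=\mathbb{R}/2\pi\mathbb{Z}$; all maps are smooth. A closed Legendre curve is a smooth map $\gamma:\mathbb{S}^1\to\mathbb{R}^2$ with a smooth unit vector field $\nu$ along it satisfying $\langle\gamma',\nu\rangle=0$; with $\mu=J\nu$ ($J$ = counterclockwise rotation by $\pi/2$), put $\ell=\langle\nu',\mu\rangle$ and $\gamma'=\beta\mu$. It is $\ell$-convex if $\ell>0$. Convention: such curves are parametrized so that $\ell\equiv1$, $\nu(\theta)=(\cos\theta,\sin\theta)$; then $\gamma(\theta)=p(\theta)(\cos\theta,\sin\theta)+p'(\theta)(-\sin\theta,\cos\theta)$ for a smooth $2\pi$-periodic support function $p$, and $\beta=p+p''$. The algebraic length and area are $L=\int_0^{2\pi}p\,d\theta=\int_0^{2\pi}\beta\,d\theta$ and $A=\frac12\int_0^{2\pi}p(p+p'')\,d\theta$. A circle is a curve with $p(\theta)=a_0+a_1\cos\theta+b_1\sin\theta$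 (radius $|a_0|$; a point is regarded as a circle of radius $0$). *)

theory Defs
  imports "HOL-Analysis.Analysis"
begin

text \<open>Maps on the circle \<open>\<real> / 2\<pi>\<int>\<close> are represented by \<open>2\<pi>\<close>-periodic maps on \<open>\<real>\<close>.\<close>

definition periodic :: "(real \<Rightarrow> 'a) \<Rightarrow> bool" where
  "periodic f \<longleftrightarrow> (\<forall>t. f (t + 2 * pi) = f t)"

definition vderiv :: "(real \<Rightarrow> 'a::real_normed_vector) \<Rightarrow> real \<Rightarrow> 'a" where
  "vderiv f t = vector_derivative f (at t)"

definition smooth :: "(real \<Rightarrow> 'a::real_normed_vector) \<Rightarrow> bool" where
  "smooth f \<longleftrightarrow> (\<forall>n t. (vderiv ^^ n) f differentiable at t)"

text \<open>Counterclockwise rotation by \<open>\<pi>/2\<close>.\<close>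

definition J :: "real^2 \<Rightarrow> real^2" where
  "J v = vector [- (v $ 2), v $ 1]"

definition closed_legendre :: "(real \<Rightarrow> real^2) \<Rightarrow> (real \<Rightarrow> real^2) \<Rightarrow> bool" where
  "closed_legendre \<gamma> \<nu> \<longleftrightarrow>
     smooth \<gamma> \<and> smooth \<nu> \<and> periodic \<gamma> \<and> periodic \<nu> \<and>
     (\<forall>t. norm (\<nu> t) = 1) \<and> (\<forall>t. vderiv \<gamma> t \<bullet> \<nu> t = 0)"

definition leg_ell :: "(real \<Rightarrow> real^2) \<Rightarrow> real \<Rightarrow> real" where
  "leg_ell \<nu> t = vderiv \<nu> t \<bullet> J (\<nu> t)"

text \<open>For a Legendre curve this is the unique function with \<open>\<gamma>' = \<beta> \<mu>\<close>, \<open>\<mu> = J \<nu>\<close>;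
  see \<open>leg_beta_iff\<close> below.\<close>

definition leg_beta :: "(real \<Rightarrow> real^2) \<Rightarrow> (real \<Rightarrow> real^2) \<Rightarrow> real \<Rightarrow> real" where
  "leg_beta \<gamma> \<nu> t = vderiv \<gamma> t \<bullet> J (\<nu> t)"

definition ell_convex :: "(real \<Rightarrow> real^2) \<Rightarrow> (real \<Rightarrow> real^2) \<Rightarrow> bool" where
  "ell_convex \<gamma> \<nu> \<longleftrightarrow> closed_legendre \<gamma> \<nu> \<and> (\<forall>t. leg_ell \<nu> t > 0)"

definition unit_normal :: "real \<Rightarrow> real^2" where
  "unit_normal \<theta> = vector [cos \<theta>, sin \<theta>]"

text \<open>The standing parametrization, in which the normal angle is the parameter.\<close>

definition normal_param :: "(real \<Rightarrow> real^2) \<Rightarrow> bool" where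
  "normal_param \<nu> \<longleftrightarrow> (\<forall>\<theta>. leg_ell \<nu> \<theta> = 1) \<and> (\<forall>\<theta>. \<nu> \<theta> = unit_normal \<theta>)"

text \<open>In the standing parametrization this is the unique \<open>p\<close> with
  \<open>\<gamma> = p (cos, sin) + p' (- sin, cos)\<close>; see \<open>support_iff\<close> below.\<close>

definition support_fun :: "(real \<Rightarrow> real^2) \<Rightarrow> (real \<Rightarrow> real^2) \<Rightarrow> real \<Rightarrow> real" where
  "support_fun \<gamma> \<nu> \<theta> = \<gamma> \<theta> \<bullet> \<nu> \<theta>"

definition alg_length :: "(real \<Rightarrow> real^2) \<Rightarrow> (real \<Rightarrow> real^2) \<Rightarrow> real" where
  "alg_length \<gamma> \<nu> = integral {0..2 * pi} (support_fun \<gamma> \<nu>)"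

definition alg_area :: "(real \<Rightarrow> real^2) \<Rightarrow> (real \<Rightarrow> real^2) \<Rightarrow> real" where
  "alg_area \<gamma> \<nu> = 1 / 2 * integral {0..2 * pi}
     (\<lambda>\<theta>. support_fun \<gamma> \<nu> \<theta> * (support_fun \<gamma> \<nu> \<theta> + deriv (deriv (support_fun \<gamma> \<nu>)) \<theta>))"

text \<open>Points are included, as circles of radius \<open>0\<close>.\<close>

definition is_circle :: "(real \<Rightarrow> real^2) \<Rightarrow> (real \<Rightarrow> real^2) \<Rightarrow> bool" where
  "is_circle \<gamma> \<nu> \<longleftrightarrow>
     (\<exists>a0 a1 b1. \<forall>\<theta>. support_fun \<gamma> \<nu> \<theta> = a0 + a1 * cos \<theta> + b1 * sin \<theta>)"

lemma leg_beta_iff: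
  assumes "closed_legendre \<gamma> \<nu>"
  shows "(\<forall>t. vderiv \<gamma> t = b t *\<^sub>R J (\<nu> t)) \<longleftrightarrow> b = leg_beta \<gamma> \<nu>"
proof -
  have unit: "\<nu> t $ 1 * \<nu> t $ 1 + \<nu> t $ 2 * \<nu> t $ 2 = 1" for t
  proof -
    have "\<nu> t \<bullet> \<nu> t = 1"
      using assms unfolding closed_legendre_def by (simp add: dot_square_norm)
    then show ?thesis by (simp add: inner_vec_def sum_2)
  qed
  have JJ: "J (\<nu> t) \<bullet> J (\<nu> t) = 1" for t
    using unit[of t] by (simp add: J_def inner_vec_def sum_2)
  have orth: "vderiv \<gamma> t $ 1 * \<nu> t $ 1 + vderiv \<gamma> t $ 2 * \<nu> t $ 2 = 0" for t
    using assms unfolding closed_legendre_def by (simp add: inner_vec_def sum_2)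
  have frame: "vderiv \<gamma> t = leg_beta \<gamma> \<nu> t *\<^sub>R J (\<nu> t)" for t
  proof -
    have "x = (y * c - x * s) * (- s) \<and> y = (y * c - x * s) * c"
      if "c * c + s * s = 1" "x * c + y * s = 0" for x y c s :: real
      using that by algebra
    from this[OF unit orth, of t]
    show ?thesis
      by (simp add: vec_eq_iff forall_2 leg_beta_def J_def inner_vec_def sum_2)
  qed
  show ?thesis
  proof
    assume b: "\<forall>t. vderiv \<gamma> t = b t *\<^sub>R J (\<nu> t)"
    show "b = leg_beta \<gamma> \<nu>"
    proof
      fix t
      show "b t = leg_beta \<gamma> \<nu> t" using b JJ[of t] by (simp add: leg_beta_def)
    qed
  qed (use frame in simp)
qed

context
  fixes \<gamma> \<nu> :: "real \<Rightarrow> real^2"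
  assumes leg: "closed_legendre \<gamma> \<nu>" and np: "normal_param \<nu>"
begin

private lemma nu: "\<nu> = unit_normal"
  using np by (auto simp: normal_param_def)

private lemma smooth_gamma: "(\<gamma> has_vector_derivative vderiv \<gamma> t) (at t)"
proof -
  have "smooth \<gamma>" using leg by (simp add: closed_legendre_def)
  then have "(vderiv ^^ 0) \<gamma> differentiable at t" unfolding smooth_def by blast
  then show ?thesis by (simp add: vderiv_def vector_derivative_works)
qed

private lemma component_deriv: "((\<lambda>t. \<gamma> t $ i) has_real_derivative vderiv \<gamma> t $ i) (at t)"
  unfolding has_real_derivative_iff_has_vector_derivative
  by (rule bounded_linear.has_vector_derivative[OF bounded_linear_vec_nth smooth_gamma])

private lemma p_eq: "support_fun \<gamma> \<nu> = (\<lambda>t. \<gamma> t $ 1 * cos t + \<gamma> t $ 2 * sin t)"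
  by (auto simp: support_fun_def nu unit_normal_def inner_vec_def sum_2)

private lemma orth: "vderiv \<gamma> t $ 1 * cos t + vderiv \<gamma> t $ 2 * sin t = 0"
  using leg by (simp add: closed_legendre_def nu unit_normal_def inner_vec_def sum_2)

lemma support_deriv: "(support_fun \<gamma> \<nu> has_real_derivative \<gamma> t \<bullet> J (\<nu> t)) (at t)"
  unfolding p_eq
  by (rule derivative_eq_intros component_deriv refl)+
    (use orth[of t] in \<open>simp add: nu unit_normal_def J_def inner_vec_def sum_2 algebra_simps\<close>)

lemma support_deriv2:
  "(deriv (support_fun \<gamma> \<nu>) has_real_derivative leg_beta \<gamma> \<nu> t - support_fun \<gamma> \<nu> t) (at t)"
proof -
  have "deriv (support_fun \<gamma> \<nu>) = (\<lambda>t. \<gamma> t $ 2 * cos t - \<gamma> t $ 1 * sin t)"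
    using DERIV_imp_deriv[OF support_deriv]
    by (auto simp: nu unit_normal_def J_def inner_vec_def sum_2)
  then show ?thesis
    apply simp
    by (rule derivative_eq_intros component_deriv refl)+
      (simp add: leg_beta_def p_eq[unfolded nu] nu unit_normal_def J_def inner_vec_def sum_2 algebra_simps)
qed

lemma leg_beta_support:
  "leg_beta \<gamma> \<nu> \<theta> = support_fun \<gamma> \<nu> \<theta> + deriv (deriv (support_fun \<gamma> \<nu>)) \<theta>"
  using DERIV_imp_deriv[OF support_deriv2] by simp

lemma support_iff:
  "(\<forall>\<theta>. q differentiable at \<theta> \<and>
      \<gamma> \<theta> = q \<theta> *\<^sub>R vector [cos \<theta>, sin \<theta>] + deriv q \<theta> *\<^sub>R vector [- sin \<theta>, cos \<theta>])
   \<longleftrightarrow> q = support_fun \<gamma> \<nu>"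
proof -
  have sc: "cos t * cos t + sin t * sin t = 1" for t :: real
    using sin_cos_squared_add[of t] by (simp add: power2_eq_square)
  have 1: "q t = support_fun \<gamma> \<nu> t"
    if "\<gamma> t = q t *\<^sub>R vector [cos t, sin t] + deriv q t *\<^sub>R vector [- sin t, cos t]" for t
  proof -
    have "(q t * cos t - d * sin t) * cos t + (q t * sin t + d * cos t) * sin t
        = q t * (cos t * cos t + sin t * sin t)" for d by algebra
    then show ?thesis using that sc[of t] by (simp add: p_eq)
  qed
  have 2: "\<gamma> t = support_fun \<gamma> \<nu> t *\<^sub>R vector [cos t, sin t]
             + deriv (support_fun \<gamma> \<nu>) t *\<^sub>R vector [- sin t, cos t]" for t
  proof -
    have "(x * c + y * s) * c - (y * c - x * s) * s = x \<and> (x * c + y * s) * s + (y * c - x * s) * c = y"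
      if "c * c + s * s = 1" for x y c s :: real
      using that by algebra
    note * = this[OF sc[of t], of "\<gamma> t $ 1" "\<gamma> t $ 2"]
    have p': "deriv (support_fun \<gamma> \<nu>) t = \<gamma> t $ 2 * cos t - \<gamma> t $ 1 * sin t"
      using DERIV_imp_deriv[OF support_deriv[of t]]
      by (simp add: nu unit_normal_def J_def inner_vec_def sum_2)
    show ?thesis
      unfolding p' using * by (simp add: vec_eq_iff forall_2 p_eq)
  qed
  have 3: "support_fun \<gamma> \<nu> differentiable at t" for t
    using support_deriv[of t] real_differentiable_def by blast
  show ?thesis using 1 2 3 by auto
qed

lemma integral_leg_beta: "(leg_beta \<gamma> \<nu> has_integral alg_length \<gamma> \<nu>) {0..2 * pi}"
proof -
  let ?p = "support_fun \<gamma> \<nu>"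
  have I1: "((\<lambda>t. leg_beta \<gamma> \<nu> t - ?p t) has_integral deriv ?p (2 * pi) - deriv ?p 0) {0..2 * pi}"
    by (rule fundamental_theorem_of_calculus)
      (auto intro!: has_field_derivative_at_within support_deriv2
            simp flip: has_real_derivative_iff_has_vector_derivative)
  have "\<gamma> (2 * pi) = \<gamma> 0" "\<nu> (2 * pi) = \<nu> 0"
    using leg unfolding closed_legendre_def periodic_def by (metis add_0)+
  then have I2: "deriv ?p (2 * pi) = deriv ?p 0"
    by (simp add: DERIV_imp_deriv[OF support_deriv])
  have "continuous_on {0..2 * pi} ?p"
    using support_deriv DERIV_isCont continuous_at_imp_continuous_on by blast
  then have I3: "(?p has_integral alg_length \<gamma> \<nu>) {0..2 * pi}"
    unfolding alg_length_def by (simp add: integrable_continuous_real integrable_integral)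
  show ?thesis
    using has_integral_add[OF I1 I3] by (simp add: I2)
qed

end

end

theory Submission
  imports Defs
begin

text \<open>Let \<open>f\<close> be the support function minus its Fourier modes of order at most \<open>1\<close>, and let
  \<open>E\<^sub>0, E\<^sub>1, E\<^sub>2\<close> be the integrals of \<open>f\<^sup>2, f'\<^sup>2, f''\<^sup>2\<close>. With \<open>D = L\<^sup>2 / (4 \<pi>) - A\<close>, integration by parts
  gives \<open>D = (E\<^sub>1 - E\<^sub>0) / 2\<close> and \<open>\<integral> \<beta>\<^sup>2 - 2 A - 8 D = E\<^sub>2 - 5 E\<^sub>1 + 4 E\<^sub>0 = \<integral> (f'' + 4 f)\<^sup>2 + 3 (E\<^sub>1 - 4 E\<^sub>0)\<close>.
  Everything follows from Wirtinger's inequality \<open>E\<^sub>1 \<ge> 4 E\<^sub>0\<close> for functions without modes of order at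
  most \<open>1\<close>; equality for \<open>\<tau> = 8\<close> forces \<open>f'' = - 4 f\<close>. That inequality is proved without Fourier series,
  by reduction to functions of period \<open>2\<pi> / 3\<close>.\<close>

section \<open>Wirtinger's inequality, first with zero boundary values, then for periodic
  functions\<close>

text \<open>For \<open>w < \<pi> / (b - a)\<close> the function \<open>t = w tan (w (x - m))\<close>, with \<open>m\<close> the midpoint, is regular on all
  of \<open>[a, b]\<close> and solves \<open>t' = w\<^sup>2 + t\<^sup>2\<close>, so that \<open>f'\<^sup>2 - w\<^sup>2 f\<^sup>2 + (t f\<^sup>2)' = (f' + t f)\<^sup>2\<close>.\<close>

lemma wirtinger_dirichlet:
  fixes f f' :: "real \<Rightarrow> real"
  assumes "a < b" and deriv: "\<And>x. (f has_real_derivative f' x) (at x)"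
    and cont: "continuous_on UNIV f'" and zero: "f a = 0" "f b = 0"
  shows "(pi / (b - a))\<^sup>2 * integral {a..b} (\<lambda>x. (f x)\<^sup>2) \<le> integral {a..b} (\<lambda>x. (f' x)\<^sup>2)"
proof -
  define W where "W = pi / (b - a)"
  define m where "m = (a + b) / 2"
  have "W > 0" using \<open>a < b\<close> by (simp add: W_def)
  have cf: "continuous_on {a..b} f"
    using deriv DERIV_isCont continuous_at_imp_continuous_on by blast
  have cf': "continuous_on {a..b} f'" using cont continuous_on_subset by blast
  have le: "w\<^sup>2 * integral {a..b} (\<lambda>x. (f x)\<^sup>2) \<le> integral {a..b} (\<lambda>x. (f' x)\<^sup>2)"
    if w: "0 < w" "w < W" for w
  proof -
    define t where "t x = w * tan (w * (x - m))" for x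
    have pos: "cos (w * (x - m)) > 0" if x: "x \<in> {a..b}" for x
    proof -
      have "\<bar>w * (x - m)\<bar> = w * \<bar>x - m\<bar>" using w by (simp add: abs_mult)
      also have "\<dots> \<le> w * ((b - a) / 2)"
        by (rule mult_left_mono) (use x w in \<open>auto simp: m_def abs_if field_simps\<close>)
      also have "\<dots> < W * ((b - a) / 2)"
        by (rule mult_strict_right_mono) (use w \<open>a < b\<close> in auto)
      also have "\<dots> = pi / 2" using \<open>a < b\<close> by (simp add: W_def)
      finally show ?thesis by (intro cos_gt_zero_pi) (auto simp: abs_less_iff)
    qed
    have dt: "(t has_real_derivative w\<^sup>2 + (t x)\<^sup>2) (at x)" if "x \<in> {a..b}" for x
    proof -
      have nz: "cos (w * (x - m)) \<noteq> 0" using pos[OF that] by simp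
      have "((\<lambda>x. w * (x - m)) has_real_derivative w) (at x)"
        by (auto intro!: derivative_eq_intros)
      from DERIV_cmult[OF DERIV_chain2[OF DERIV_tan[OF nz] this], of w]
      have "(t has_real_derivative w * (inverse ((cos (w * (x - m)))\<^sup>2) * w)) (at x)"
        by (simp add: t_def[abs_def])
      moreover have "w * (inverse ((cos (w * (x - m)))\<^sup>2) * w) = w\<^sup>2 + (t x)\<^sup>2"
        unfolding t_def power_mult_distrib power_inverse[symmetric] tan_sec[OF nz, symmetric]
        by (simp add: power2_eq_square algebra_simps)
      ultimately show ?thesis by simp
    qed
    have "((\<lambda>x. (w\<^sup>2 + (t x)\<^sup>2) * (f x)\<^sup>2 + t x * (2 * f x * f' x)) has_integral
            t b * (f b)\<^sup>2 - t a * (f a)\<^sup>2) {a..b}"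
    proof (rule fundamental_theorem_of_calculus)
      show "((\<lambda>x. t x * (f x)\<^sup>2) has_vector_derivative
          (w\<^sup>2 + (t x)\<^sup>2) * (f x)\<^sup>2 + t x * (2 * f x * f' x)) (at x within {a..b})"
        if "x \<in> {a..b}" for x
        unfolding has_real_derivative_iff_has_vector_derivative[symmetric]
        by (rule has_field_derivative_at_within)
          (auto intro!: derivative_eq_intros dt[OF that] deriv simp: algebra_simps)
    qed (use \<open>a < b\<close> in simp)
    then have I1: "((\<lambda>x. (w\<^sup>2 + (t x)\<^sup>2) * (f x)\<^sup>2 + t x * (2 * f x * f' x)) has_integral 0) {a..b}"
      by (simp add: zero)
    have I2: "((\<lambda>x. (f' x)\<^sup>2 - w\<^sup>2 * (f x)\<^sup>2) has_integral
        integral {a..b} (\<lambda>x. (f' x)\<^sup>2) - w\<^sup>2 * integral {a..b} (\<lambda>x. (f x)\<^sup>2)) {a..b}"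
      by (intro has_integral_diff has_integral_mult_right integrable_integral
            integrable_continuous_real continuous_intros cf cf')
    have "0 \<le> integral {a..b} (\<lambda>x. (f' x)\<^sup>2) - w\<^sup>2 * integral {a..b} (\<lambda>x. (f x)\<^sup>2) + 0"
    proof (rule has_integral_nonneg[OF has_integral_add[OF I2 I1]])
      fix x
      have "(f' x)\<^sup>2 - w\<^sup>2 * (f x)\<^sup>2 + ((w\<^sup>2 + (t x)\<^sup>2) * (f x)\<^sup>2 + t x * (2 * f x * f' x))
          = (f' x + t x * f x)\<^sup>2" by (simp add: power2_eq_square algebra_simps)
      then show "0 \<le> (f' x)\<^sup>2 - w\<^sup>2 * (f x)\<^sup>2 +
          ((w\<^sup>2 + (t x)\<^sup>2) * (f x)\<^sup>2 + t x * (2 * f x * f' x))" by simp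
    qed
    then show ?thesis by simp
  qed
  have "((\<lambda>w. w\<^sup>2 * integral {a..b} (\<lambda>x. (f x)\<^sup>2)) \<longlongrightarrow> W\<^sup>2 * integral {a..b} (\<lambda>x. (f x)\<^sup>2)) (at_left W)"
    by (intro tendsto_intros)
  then have "W\<^sup>2 * integral {a..b} (\<lambda>x. (f x)\<^sup>2) \<le> integral {a..b} (\<lambda>x. (f' x)\<^sup>2)"
    by (rule tendsto_upperbound)
      (use le eventually_at_left_real[OF \<open>W > 0\<close>] in \<open>auto elim: eventually_mono\<close>)
  then show ?thesis by (simp add: W_def)
qed

lemma integral_period_shift:
  fixes g :: "real \<Rightarrow> real"
  assumes "continuous_on UNIV g" and per: "\<And>x. g (x + T) = g x" and c: "0 \<le> c" "c \<le> T"
  shows "integral {c..c + T} g = integral {0..T} g"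
proof -
  have int: "g integrable_on {a..b}" for a b
    using assms(1) by (meson continuous_on_subset integrable_continuous_real top_greatest)
  have "integral {0..c} (g \<circ> (\<lambda>x. x + T)) = integral {0 + T..c + T} g"
    by (rule integral_shift) (use assms(1) continuous_on_subset in blast)
  moreover have "g \<circ> (\<lambda>x. x + T) = g" using per by auto
  ultimately have "integral {T..c + T} g = integral {0..c} g" by simp
  moreover have "integral {c..T} g + integral {T..c + T} g = integral {c..c + T} g"
    by (rule Henstock_Kurzweil_Integration.integral_combine) (use c int in auto)
  moreover have "integral {0..c} g + integral {c..T} g = integral {0..T} g"
    by (rule Henstock_Kurzweil_Integration.integral_combine) (use c int in auto)
  ultimately show ?thesis by simp
qed

text \<open>The difference of \<open>f (x + T / 2)\<close> and \<open>f x\<close> changes sign over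
  half a period, so \<open>f\<close> takes a common value \<open>k\<close> at two points
  \<open>x\<close> and \<open>x + T / 2\<close>. Then \<open>g = f - k\<close> vanishes at both ends
  of two adjacent half periods, and the Dirichlet inequality on each, of length
  \<open>T / 2\<close>, has exactly the constant wanted. Passing from \<open>g\<close> back to
  \<open>f\<close> is harmless: as \<open>f\<close> has mean zero, subtracting \<open>k\<close> can
  only increase the integral of the square.\<close>

lemma wirtinger_periodic:
  fixes f f' :: "real \<Rightarrow> real"
  assumes "T > 0" and deriv: "\<And>x. (f has_real_derivative f' x) (at x)"
    and cont: "continuous_on UNIV f'" and per: "\<And>x. f (x + T) = f x" and per': "\<And>x. f' (x + T) = f' x"
    and mean: "integral {0..T} f = 0"
  shows "(2 * pi / T)\<^sup>2 * integral {0..T} (\<lambda>x. (f x)\<^sup>2) \<le> integral {0..T} (\<lambda>x. (f' x)\<^sup>2)"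
proof -
  have cf: "continuous_on S f" for S
    using deriv DERIV_isCont continuous_at_imp_continuous_on by blast
  have cf': "continuous_on S f'" for S using cont continuous_on_subset by blast
  have "\<exists>x. 0 \<le> x \<and> x \<le> T / 2 \<and> f x = f (x + T / 2)"
  proof -
    define h where "h x = f (x + T / 2) - f x" for x
    have ch: "continuous_on S h" for S unfolding h_def
      by (intro continuous_intros continuous_on_compose2[OF cf[of UNIV]]) auto
    have "h (T / 2) = - h 0" using per[of 0] by (simp add: h_def)
    then have "h 0 \<le> 0 \<and> 0 \<le> h (T / 2) \<or> h (T / 2) \<le> 0 \<and> 0 \<le> h 0" by linarith
    then have "\<exists>x. 0 \<le> x \<and> x \<le> T / 2 \<and> h x = 0"
      using IVT'[of h 0 0 "T / 2"] IVT2'[of h "T / 2" 0 0] ch \<open>T > 0\<close> by fastforce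
    then show ?thesis by (auto simp: h_def)
  qed
  then obtain x where x: "0 \<le> x" "x \<le> T / 2" "f x = f (x + T / 2)" by blast
  define k where "k = f x"
  define g where "g y = f y - k" for y
  have dg: "(g has_real_derivative f' y) (at y)" for y
    using DERIV_diff[OF deriv DERIV_const] by (simp add: g_def[abs_def])
  have gz: "g x = 0" "g (x + T / 2) = 0" "g (x + T) = 0" using x per by (auto simp: g_def k_def)
  have cg: "continuous_on S g" for S unfolding g_def by (intro continuous_intros cf)
  have ints: "(\<lambda>y. (g y)\<^sup>2) integrable_on {a..b}" "(\<lambda>y. (f' y)\<^sup>2) integrable_on {a..b}" for a b
    by (intro integrable_continuous_real continuous_intros cg cf')+
  have h1: "(pi / (x + T / 2 - x))\<^sup>2 * integral {x..x + T / 2} (\<lambda>y. (g y)\<^sup>2)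
      \<le> integral {x..x + T / 2} (\<lambda>y. (f' y)\<^sup>2)"
    by (rule wirtinger_dirichlet) (use \<open>T > 0\<close> dg cont x in \<open>auto simp: gz\<close>)
  have h2: "(pi / (x + T - (x + T / 2)))\<^sup>2 * integral {x + T / 2..x + T} (\<lambda>y. (g y)\<^sup>2)
      \<le> integral {x + T / 2..x + T} (\<lambda>y. (f' y)\<^sup>2)"
    by (rule wirtinger_dirichlet) (use \<open>T > 0\<close> dg cont x in \<open>auto simp: gz\<close>)
  have split: "integral {x..x + T / 2} h + integral {x + T / 2..x + T} h = integral {0..T} h"
    if "continuous_on UNIV h" "\<And>y. h (y + T) = h y" for h :: "real \<Rightarrow> real"
  proof -
    have "integral {x..x + T / 2} h + integral {x + T / 2..x + T} h = integral {x..x + T} h"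
      by (rule Henstock_Kurzweil_Integration.integral_combine)
        (use \<open>T > 0\<close> that(1) continuous_on_subset in \<open>auto intro!: integrable_continuous_real\<close>)
    also have "\<dots> = integral {0..T} h"
      by (rule integral_period_shift) (use that x in auto)
    finally show ?thesis .
  qed
  have split_g: "integral {x..x + T / 2} (\<lambda>y. (g y)\<^sup>2) + integral {x + T / 2..x + T} (\<lambda>y. (g y)\<^sup>2)
      = integral {0..T} (\<lambda>y. (g y)\<^sup>2)"
    by (rule split) (auto intro!: continuous_intros cf simp: g_def per)
  have split_f': "integral {x..x + T / 2} (\<lambda>y. (f' y)\<^sup>2) + integral {x + T / 2..x + T} (\<lambda>y. (f' y)\<^sup>2)
      = integral {0..T} (\<lambda>y. (f' y)\<^sup>2)"
    by (rule split) (auto intro!: continuous_intros cf' simp: per')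
  have "pi / (x + T / 2 - x) = 2 * pi / T" "pi / (x + T - (x + T / 2)) = 2 * pi / T" by simp_all
  then have *: "(2 * pi / T)\<^sup>2 * integral {0..T} (\<lambda>y. (g y)\<^sup>2) \<le> integral {0..T} (\<lambda>y. (f' y)\<^sup>2)"
    using add_mono[OF h1 h2] by (simp only: split_f' distrib_left[symmetric] split_g)
  have "((\<lambda>y. k\<^sup>2) has_integral T * k\<^sup>2) {0..T}"
    using has_integral_const_real[of "k\<^sup>2" 0 T] \<open>T > 0\<close> by simp
  then have "((\<lambda>y. (f y)\<^sup>2 - 2 * k * f y + k\<^sup>2) has_integral
      integral {0..T} (\<lambda>y. (f y)\<^sup>2) - 2 * k * integral {0..T} f + T * k\<^sup>2) {0..T}"
    by (intro has_integral_add has_integral_diff has_integral_mult_right integrable_integral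
          integrable_continuous_real continuous_intros cf)
  moreover have "(\<lambda>y. (f y)\<^sup>2 - 2 * k * f y + k\<^sup>2) = (\<lambda>y. (g y)\<^sup>2)"
    by (auto simp: g_def power2_eq_square algebra_simps)
  ultimately have "integral {0..T} (\<lambda>y. (g y)\<^sup>2) = integral {0..T} (\<lambda>y. (f y)\<^sup>2) + T * k\<^sup>2"
    by (simp add: integral_unique mean)
  then have "integral {0..T} (\<lambda>y. (f y)\<^sup>2) \<le> integral {0..T} (\<lambda>y. (g y)\<^sup>2)"
    using \<open>T > 0\<close> by simp
  then have "(2 * pi / T)\<^sup>2 * integral {0..T} (\<lambda>y. (f y)\<^sup>2) \<le> (2 * pi / T)\<^sup>2 * integral {0..T} (\<lambda>y. (g y)\<^sup>2)"
    by (rule mult_left_mono) simp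
  then show ?thesis using * by linarith
qed

section \<open>Averaging over translations by a third of the period, and Wirtinger's inequality
  without modes of order at most 1\<close>

text \<open>On functions of period 2\<pi> this is the projection onto the Fourier modes whose
  frequency is divisible by 3. Multiplying by \<open>cos\<close> or \<open>sin\<close> before
  averaging captures the other two residue classes.\<close>

definition avg3 :: "(real \<Rightarrow> real) \<Rightarrow> real \<Rightarrow> real" where
  "avg3 g x = (g x + g (x + 2 * pi / 3) + g (x + 4 * pi / 3)) / 3"

lemma avg3_periodic:
  assumes "periodic g"
  shows "avg3 g (x + 2 * pi / 3) = avg3 g x"
proof -
  have "x + 2 * pi / 3 + 4 * pi / 3 = x + 2 * pi" by simp
  then have "g (x + 2 * pi / 3 + 4 * pi / 3) = g x"
    using assms by (simp only: periodic_def)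
  moreover have "x + 2 * pi / 3 + 2 * pi / 3 = x + 4 * pi / 3" by simp
  ultimately show ?thesis by (simp only: avg3_def) simp
qed

lemma continuous_on_avg3:
  assumes "continuous_on UNIV g"
  shows "continuous_on S (avg3 g)"
  unfolding avg3_def
  by (intro continuous_intros continuous_on_compose2[OF assms]) auto

lemma avg3_has_derivative:
  assumes "\<And>x. (g has_real_derivative g' x) (at x)"
  shows "(avg3 g has_real_derivative avg3 g' x) (at x)"
  unfolding avg3_def
  by (auto intro!: derivative_eq_intros DERIV_chain'[OF _ assms, THEN DERIV_cong])

text \<open>Carries mean values and integrals of squares over to the shorter period, where the
  constant in Wirtinger's inequality is 9.\<close>

lemma integral_avg3:
  assumes "continuous_on UNIV g"
  shows "integral {0..2 * pi} g = 3 * integral {0..2 * pi / 3} (avg3 g)"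
proof -
  define T where "T = 2 * pi / 3"
  have T: "0 < T" "2 * pi = 3 * T" "2 * T = 4 * pi / 3" by (auto simp: T_def)
  have int: "h integrable_on {a..b}" if "continuous_on UNIV h" for a b and h :: "real \<Rightarrow> real"
    using that by (meson continuous_on_subset integrable_continuous_real top_greatest)
  have c: "continuous_on UNIV (\<lambda>x. g (x + d))" for d
    by (intro continuous_on_compose2[OF assms] continuous_intros) auto
  have sh: "integral {0..T} (\<lambda>x. g (x + d)) = integral {d..T + d} g" for d
    using integral_shift[of 0 d T g] continuous_on_subset[OF assms, of "{0 + d..T + d}"] by (simp add: o_def)
  have "integral {0..T} g + integral {T..2 * T} g = integral {0..2 * T} g"
    by (rule Henstock_Kurzweil_Integration.integral_combine) (use T int[OF assms] in auto)
  moreover have "integral {0..2 * T} g + integral {2 * T..3 * T} g = integral {0..3 * T} g"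
    by (rule Henstock_Kurzweil_Integration.integral_combine) (use T int[OF assms] in auto)
  moreover have "integral {0..T} (\<lambda>x. (g x + g (x + T) + g (x + 2 * T)) / 3)
    = (integral {0..T} g + integral {0..T} (\<lambda>x. g (x + T)) + integral {0..T} (\<lambda>x. g (x + 2 * T))) / 3"
    using c assms int by (simp add: integral_add integrable_add)
  ultimately show ?thesis
    unfolding T(2) T_def[symmetric] avg3_def T(3)[symmetric] sh by simp
qed

text \<open>Parseval's identity for the characters of the group of translations by multiples of \<open>2\<pi>/3\<close>.\<close>

lemma avg3_square:
  "avg3 (\<lambda>x. (g x)\<^sup>2) x = (avg3 g x)\<^sup>2 + 2 * (avg3 (\<lambda>x. g x * cos x) x)\<^sup>2 + 2 * (avg3 (\<lambda>x. g x * sin x) x)\<^sup>2"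
proof -
  \<comment> \<open>The points \<open>(c0, s0)\<close>, \<open>(c1, s1)\<close>,
    \<open>(c2, s2)\<close> are the vertices of an equilateral triangle on the unit circle, hence
    the inner products -1/2. The two trigonometric squares then sum to 1/9 of
    \<open>a^2 + b^2 + d^2 - a b - b d - a d\<close>, and the mixed terms cancel against those of
    the first square.\<close>
  have *: "(a\<^sup>2 + b\<^sup>2 + d\<^sup>2) / 3 = ((a + b + d) / 3)\<^sup>2 +
      2 * ((a * c0 + b * c1 + d * c2) / 3)\<^sup>2 + 2 * ((a * s0 + b * s1 + d * s2) / 3)\<^sup>2"
    if "c0 * c0 + s0 * s0 = 1" "c1 * c1 + s1 * s1 = 1" "c2 * c2 + s2 * s2 = 1"
      "c0 * c1 + s0 * s1 = - 1/2" "c1 * c2 + s1 * s2 = - 1/2" "c0 * c2 + s0 * s2 = - 1/2"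
    for a b d c0 c1 c2 s0 s1 s2 :: real
  proof -
    have "((a * c0 + b * c1 + d * c2) / 3)\<^sup>2 + ((a * s0 + b * s1 + d * s2) / 3)\<^sup>2
        = (a\<^sup>2 * (c0 * c0 + s0 * s0) + b\<^sup>2 * (c1 * c1 + s1 * s1) + d\<^sup>2 * (c2 * c2 + s2 * s2)
          + 2 * a * b * (c0 * c1 + s0 * s1) + 2 * b * d * (c1 * c2 + s1 * s2)
          + 2 * a * d * (c0 * c2 + s0 * s2)) / 9"
      by (simp add: power2_eq_square field_simps)
    then show ?thesis unfolding that by (simp add: power2_eq_square field_simps)
  qed
  have u: "cos y * cos y + sin y * sin y = 1" for y :: real
    using sin_cos_squared_add2[of y] by (simp add: power2_eq_square)
  have cd: "cos y * cos z + sin y * sin z = cos (z - y)" for y z :: real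
    by (simp add: cos_diff)
  have c1: "cos (2 * pi / 3) = - 1/2" using cos_120 by simp
  have c2: "cos (4 * pi / 3) = - 1/2"
    using cos_periodic_pi[of "pi / 3"] cos_60 by (simp add: field_simps)
  show ?thesis unfolding avg3_def
    by (rule *) (use c1 c2 in \<open>simp_all only: u cd\<close>, simp_all)
qed

text \<open>The averages of \<open>f\<close>, \<open>f cos\<close> and \<open>f sin\<close> have period \<open>2\<pi>/3\<close> and mean zero, so each satisfies
  Wirtinger's inequality with constant \<open>9\<close>; undoing the multiplication by \<open>cos\<close> and \<open>sin\<close> shifts
  frequencies by one and costs at most a drop from \<open>3\<^sup>2\<close> to \<open>2\<^sup>2\<close>.\<close>

lemma wirtinger_second:
  fixes f f' :: "real \<Rightarrow> real"
  assumes deriv: "\<And>x. (f has_real_derivative f' x) (at x)"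
    and cont: "continuous_on UNIV f'" and per: "periodic f" and per': "periodic f'"
    and orth: "integral {0..2 * pi} f = 0" "integral {0..2 * pi} (\<lambda>x. f x * cos x) = 0"
      "integral {0..2 * pi} (\<lambda>x. f x * sin x) = 0"
  shows "4 * integral {0..2 * pi} (\<lambda>x. (f x)\<^sup>2) \<le> integral {0..2 * pi} (\<lambda>x. (f' x)\<^sup>2)"
proof -
  define T where "T = 2 * pi / 3"
  have cf: "continuous_on UNIV f"
    using deriv DERIV_isCont continuous_at_imp_continuous_on by blast
  let ?I = "\<lambda>h :: real \<Rightarrow> real. integral {0..T} (\<lambda>x. (h x)\<^sup>2)"
  \<comment> \<open>\<open>C'\<close> and \<open>S'\<close> are the derivatives of \<open>C\<close>
    and \<open>S\<close>, to which Wirtinger's inequality applies. What Parseval's identity for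
    \<open>f'\<close> calls for is \<open>c\<close> and \<open>s\<close>, which differ from them by
    \<open>S\<close> and \<open>C\<close> up to sign.\<close>
  define C S C' S' c s where "C = avg3 (\<lambda>x. f x * cos x)" and "S = avg3 (\<lambda>x. f x * sin x)"
    and "C' = avg3 (\<lambda>x. f' x * cos x - f x * sin x)" and "S' = avg3 (\<lambda>x. f' x * sin x + f x * cos x)"
    and "c = avg3 (\<lambda>x. f' x * cos x)" and "s = avg3 (\<lambda>x. f' x * sin x)"
  note defs = this
  have W: "9 * ?I (avg3 h) \<le> ?I (avg3 h')"
    if "\<And>x. (h has_real_derivative h' x) (at x)" "continuous_on UNIV h'" "periodic h" "periodic h'"
      "integral {0..2 * pi} h = 0" for h h'
  proof -
    have ch: "continuous_on UNIV h"
      using that(1) DERIV_isCont continuous_at_imp_continuous_on by blast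
    have "(2 * pi / T)\<^sup>2 * ?I (avg3 h) \<le> ?I (avg3 h')"
      by (rule wirtinger_periodic)
        (use that ch in \<open>auto simp: T_def avg3_periodic continuous_on_avg3 integral_avg3
           intro!: avg3_has_derivative\<close>)
    then show ?thesis by (simp add: T_def)
  qed
  have pc: "periodic (cos :: real \<Rightarrow> real)" "periodic (sin :: real \<Rightarrow> real)" by (auto simp: periodic_def)
  have W0: "9 * ?I (avg3 f) \<le> ?I (avg3 f')" by (rule W) (use assms in auto)
  have W1: "9 * ?I C \<le> ?I C'" unfolding defs
    by (rule W) (use assms cf pc in \<open>auto intro!: derivative_eq_intros continuous_intros simp: periodic_def\<close>)
  have W2: "9 * ?I S \<le> ?I S'" unfolding defs
    by (rule W) (use assms cf pc in \<open>auto intro!: derivative_eq_intros continuous_intros simp: periodic_def\<close>)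
  have cs: "c x = C' x + S x" "s x = S' x - C x" for x
    unfolding defs avg3_def by (simp_all add: field_simps)
  have conts: "continuous_on {0..T} (avg3 f)" "continuous_on {0..T} (avg3 f')"
    "continuous_on {0..T} C" "continuous_on {0..T} S" "continuous_on {0..T} C'"
    "continuous_on {0..T} S'" "continuous_on {0..T} c" "continuous_on {0..T} s"
    unfolding defs by (intro continuous_on_avg3 continuous_intros cf cont)+
  \<comment> \<open>This is Young's inequality with its parameter at the best value 1/3. Together
    with the constant 9, the bounds for \<open>c\<close> and \<open>s\<close> add up to the factor
    2/3 * 9 - 2 = 4 in front of the integrals of \<open>C^2\<close> and \<open>S^2\<close>; any
    other parameter gives less.\<close>
  have young: "2/3 * u\<^sup>2 - 2 * v\<^sup>2 \<le> (u + v)\<^sup>2" for u v :: real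
  proof -
    have "(u + v)\<^sup>2 - (2/3 * u\<^sup>2 - 2 * v\<^sup>2) = (u + 3 * v)\<^sup>2 / 3" by (simp add: power2_eq_square field_simps)
    then show ?thesis by (smt (verit) zero_le_power2 divide_nonneg_nonneg)
  qed
  have Y: "2/3 * ?I u - 2 * ?I v \<le> ?I w"
    if "continuous_on {0..T} u" "continuous_on {0..T} v" "continuous_on {0..T} w"
      "\<And>x. 2/3 * (u x)\<^sup>2 - 2 * (v x)\<^sup>2 \<le> (w x)\<^sup>2" for u v w
  proof (rule has_integral_le)
    show "((\<lambda>x. 2/3 * (u x)\<^sup>2 - 2 * (v x)\<^sup>2) has_integral 2/3 * ?I u - 2 * ?I v) {0..T}"
      by (intro has_integral_diff has_integral_mult_right integrable_integral
            integrable_continuous_real continuous_intros that)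
    show "((\<lambda>x. (w x)\<^sup>2) has_integral ?I w) {0..T}"
      by (intro integrable_integral integrable_continuous_real continuous_intros that)
  qed (rule that)
  have Y1: "2/3 * ?I C' - 2 * ?I S \<le> ?I c"
    by (rule Y) (use conts young in \<open>auto simp: cs\<close>)
  have Y2: "2/3 * ?I S' - 2 * ?I C \<le> ?I s"
    by (rule Y) (use conts young[of _ "- _"] in \<open>auto simp: cs\<close>)
  have P: "integral {0..2 * pi} (\<lambda>x. (h x)\<^sup>2) =
      3 * (?I (avg3 h) + 2 * ?I (avg3 (\<lambda>x. h x * cos x)) + 2 * ?I (avg3 (\<lambda>x. h x * sin x)))"
    if ch: "continuous_on UNIV h" for h
  proof -
    have "avg3 (\<lambda>x. (h x)\<^sup>2) = (\<lambda>x. (avg3 h x)\<^sup>2 + 2 * (avg3 (\<lambda>x. h x * cos x) x)\<^sup>2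
        + 2 * (avg3 (\<lambda>x. h x * sin x) x)\<^sup>2)"
      using avg3_square by blast
    then have "(avg3 (\<lambda>x. (h x)\<^sup>2) has_integral
       ?I (avg3 h) + 2 * ?I (avg3 (\<lambda>x. h x * cos x)) + 2 * ?I (avg3 (\<lambda>x. h x * sin x))) {0..T}"
      by (auto intro!: has_integral_add has_integral_mult_right integrable_integral
           integrable_continuous_real continuous_intros continuous_on_avg3 ch)
    moreover have "continuous_on UNIV (\<lambda>x. (h x)\<^sup>2)" by (intro continuous_intros ch)
    ultimately show ?thesis by (simp add: integral_avg3 T_def integral_unique)
  qed
  have nn: "0 \<le> ?I (avg3 f)" by (intro integral_nonneg integrable_continuous_real continuous_intros conts) auto
  \<comment> \<open>After Parseval on both sides, the plain averages compare with 9 in place of 4,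
    and the trigonometric ones with exactly 4 once \<open>Y1\<close> and \<open>Y2\<close> are
    added.\<close>
  show ?thesis
    using P[OF cf, folded C_def S_def] P[OF cont, folded c_def s_def] W0 W1 W2 Y1 Y2 nn by argo
qed

section \<open>Periodic functions and the harmonic oscillator\<close>

lemma periodic_derivative:
  fixes f f' :: "real \<Rightarrow> real"
  assumes "periodic f" and "\<And>x. (f has_real_derivative f' x) (at x)"
  shows "periodic f'"
proof -
  have "f' (x + 2 * pi) = f' x" for x
  proof -
    have "((\<lambda>x. f (x + 2 * pi)) has_real_derivative f' (x + 2 * pi)) (at x)"
      using assms(2)[of "x + 2 * pi"] by (simp add: DERIV_shift)
    moreover have "(\<lambda>x. f (x + 2 * pi)) = f" using assms(1) by (auto simp: periodic_def)
    ultimately show ?thesis using DERIV_unique[OF _ assms(2)] by simp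
  qed
  then show ?thesis by (simp add: periodic_def)
qed

lemma periodic_zero:
  fixes f :: "real \<Rightarrow> real"
  assumes "periodic f" and zero: "\<And>x. x \<in> {0..2 * pi} \<Longrightarrow> f x = 0"
  shows "f x = 0"
proof -
  interpret periodic_fun_simple f "2 * pi"
    using assms by unfold_locales (auto simp: periodic_def)
  define k where "k = \<lfloor>x / (2 * pi)\<rfloor>"
  have "real_of_int k \<le> x / (2 * pi)" "x / (2 * pi) < real_of_int k + 1"
    unfolding k_def by linarith+
  then have "x - of_int k * (2 * pi) \<in> {0..2 * pi}" by (auto simp: field_simps)
  then show ?thesis using zero minus_of_int[of x k] by simp
qed

lemma periodic_integral_square_zero:
  fixes f :: "real \<Rightarrow> real"
  assumes "periodic f" and "continuous_on UNIV f" and "integral {0..2 * pi} (\<lambda>x. (f x)\<^sup>2) = 0"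
  shows "f x = 0"
proof (rule periodic_zero[OF assms(1)])
  have c: "continuous_on {0..2 * pi} (\<lambda>x. (f x)\<^sup>2)"
    using assms(2) by (intro continuous_intros) (rule continuous_on_subset, auto)
  show "f y = 0" if "y \<in> {0..2 * pi}" for y
    using integral_eq_0_iff[OF c] assms(3) that by simp
qed

text \<open>The phase point \<open>(f, f' / 2)\<close> rotates with angular speed 2. Its coordinates
  \<open>a\<close> and \<open>b\<close> in the co-rotating frame are constant, and turning back
  recovers \<open>f\<close>.\<close>

lemma oscillator_solution:
  fixes f f' :: "real \<Rightarrow> real"
  assumes "\<And>x. (f has_real_derivative f' x) (at x)"
    and "\<And>x. (f' has_real_derivative - 4 * f x) (at x)"
  shows "f x = f 0 * cos (2 * x) + f' 0 / 2 * sin (2 * x)"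
proof -
  define a where "a x = f x * cos (2 * x) - f' x / 2 * sin (2 * x)" for x
  define b where "b x = f x * sin (2 * x) + f' x / 2 * cos (2 * x)" for x
  have "(a has_real_derivative 0) (at x)" for x
    unfolding a_def by (auto intro!: derivative_eq_intros assms)
  then have a: "a x = f 0" using DERIV_isconst_all[of a x 0] by (simp add: a_def)
  have "(b has_real_derivative 0) (at x)" for x
    unfolding b_def by (auto intro!: derivative_eq_intros assms simp: field_simps)
  then have b: "b x = f' 0 / 2" using DERIV_isconst_all[of b x 0] by (simp add: b_def)
  have "(u * c - v / 2 * s) * c + (u * s + v / 2 * c) * s = u * (s\<^sup>2 + c\<^sup>2)" for u v c s :: real
    by (simp add: power2_eq_square algebra_simps)
  then have "a x * cos (2 * x) + b x * sin (2 * x) = f x"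
    by (simp add: a_def b_def)
  then show ?thesis by (simp add: a b)
qed

section \<open>The estimates for the support function\<close>

text \<open>\<open>D\<close> is the isoperimetric deficit and \<open>R\<close> the gap between the
  two sides for \<tau> = 8. For general \<tau> the gap is \<open>R + (8 - \<tau>) * D\<close>, so
  the signs and zero cases of these two numbers settle all values of \<tau> at once.\<close>

lemma support_function_bounds:
  fixes p p' \<beta> :: "real \<Rightarrow> real" and L A :: real
  assumes dp: "\<And>x. (p has_real_derivative p' x) (at x)"
    and dp': "\<And>x. (p' has_real_derivative \<beta> x - p x) (at x)"
    and c\<beta>: "continuous_on UNIV \<beta>" and per: "periodic p"
  defines "L \<equiv> integral {0..2 * pi} p"
    and "A \<equiv> 1 / 2 * integral {0..2 * pi} (\<lambda>x. p x * \<beta> x)"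
  defines "D \<equiv> L\<^sup>2 / (4 * pi) - A"
  defines "R \<equiv> integral {0..2 * pi} (\<lambda>x. (\<beta> x)\<^sup>2) - 2 * A - 8 * D"
  shows "D \<ge> 0" and "D = 0 \<Longrightarrow> \<exists>a0 a1 b1. \<forall>x. p x = a0 + a1 * cos x + b1 * sin x"
    and "R \<ge> 0" and "R = 0 \<Longrightarrow> \<exists>a0 a1 b1 a2 b2. \<forall>x. p x =
      a0 + a1 * cos x + b1 * sin x + a2 * cos (2 * x) + b2 * sin (2 * x)"
proof -
  define a0 a1 b1 where "a0 = L / (2 * pi)" and "a1 = integral {0..2 * pi} (\<lambda>x. p x * cos x) / pi"
    and "b1 = integral {0..2 * pi} (\<lambda>x. p x * sin x) / pi"
  \<comment> \<open>\<open>h\<close> is the support function of the point \<open>(a1, b1)\<close>.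
    Since its second derivative is \<open>- h\<close>, it drops out of \<open>\<beta>\<close>, which
    becomes \<open>f + f'' + a0\<close>.\<close>
  define h h' where "h x = a1 * cos x + b1 * sin x" and "h' x = b1 * cos x - a1 * sin x" for x
  define f f' f'' where "f x = p x - a0 - h x" and "f' x = p' x - h' x"
    and "f'' x = \<beta> x - p x + h x" for x
  have dh: "(h has_real_derivative h' x) (at x)" "(h' has_real_derivative - h x) (at x)" for x
    unfolding h_def h'_def by (auto intro!: derivative_eq_intros)
  have df: "(f has_real_derivative f' x) (at x)" "(f' has_real_derivative f'' x) (at x)" for x
    unfolding f_def f'_def f''_def by (auto intro!: derivative_eq_intros dp dp' dh)
  have perh: "periodic h" "periodic h'" by (auto simp: periodic_def h_def h'_def)
  have perf: "periodic f" using per perh by (simp add: periodic_def f_def)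
  have perf': "periodic f'" by (rule periodic_derivative[OF perf df(1)])
  have perf'': "periodic f''" by (rule periodic_derivative[OF perf' df(2)])
  have cont: "continuous_on S p" "continuous_on S h" "continuous_on S f" "continuous_on S f'" for S
    using dp dh(1) df by (auto intro!: continuous_at_imp_continuous_on DERIV_isCont)
  have cf'': "continuous_on S f''" for S
    unfolding f''_def by (intro continuous_intros cont continuous_on_subset[OF c\<beta>]) auto
  let ?I = "\<lambda>h :: real \<Rightarrow> real. integral {0..2 * pi} h"
  have hasI: "(k has_integral ?I k) {0..2 * pi}" if "continuous_on {0..2 * pi} k" for k
    using that by (simp add: integrable_continuous_real integrable_integral)
  have FTC: "(k' has_integral 0) {0..2 * pi}"
    if "\<And>x. (k has_real_derivative k' x) (at x)" "k (2 * pi) = k 0" for k k'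
  proof -
    have "(k' has_integral k (2 * pi) - k 0) {0..2 * pi}"
      by (rule fundamental_theorem_of_calculus)
        (auto intro!: has_field_derivative_at_within that(1)
              simp flip: has_real_derivative_iff_has_vector_derivative)
    then show ?thesis using that(2) by simp
  qed
  have ends: "k (2 * pi) = k 0" if "periodic k" for k :: "real \<Rightarrow> real"
    using that unfolding periodic_def by (metis add_0)
  have const: "((\<lambda>x. c) has_integral 2 * pi * c) {0..2 * pi}" for c :: real
    using has_integral_const_real[of c 0 "2 * pi"] by simp
  have icos: "(cos has_integral 0) {0..2 * pi}" and isin: "(sin has_integral 0) {0..2 * pi}"
    by (rule FTC[of sin], auto intro!: derivative_eq_intros)
      (rule FTC[of "\<lambda>x. - cos x"], auto intro!: derivative_eq_intros)
  have isc: "((\<lambda>x. sin x * cos x) has_integral 0) {0..2 * pi}"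
    by (rule FTC[of "\<lambda>x. (sin x)\<^sup>2 / 2"]) (auto intro!: derivative_eq_intros)
  have icc_iss: "((\<lambda>x. (cos x)\<^sup>2 - (sin x)\<^sup>2) has_integral 0) {0..2 * pi}"
    by (rule FTC[of "\<lambda>x. sin x * cos x"]) (auto intro!: derivative_eq_intros simp: power2_eq_square)
  have "1/2 * (1 + ((cos x)\<^sup>2 - (sin x)\<^sup>2)) = (cos x)\<^sup>2" for x :: real
    using sin_cos_squared_add[of x] by argo
  then have icc: "((\<lambda>x. (cos x)\<^sup>2) has_integral pi) {0..2 * pi}"
    using has_integral_mult_right[OF has_integral_add[OF const[of 1] icc_iss], of "1/2"] by (simp only:) simp
  have "1/2 * (1 - ((cos x)\<^sup>2 - (sin x)\<^sup>2)) = (sin x)\<^sup>2" for x :: real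
    using sin_cos_squared_add[of x] by argo
  then have iss: "((\<lambda>x. (sin x)\<^sup>2) has_integral pi) {0..2 * pi}"
    using has_integral_mult_right[OF has_integral_diff[OF const[of 1] icc_iss], of "1/2"] by (simp only:) simp
  \<comment> \<open>The next three integrals verify that \<open>f\<close> is orthogonal to 1,
    \<open>cos\<close> and \<open>sin\<close>, as \<open>wirtinger_second\<close> requires.\<close>
  have "((\<lambda>x. p x - a0 - (a1 * cos x + b1 * sin x)) has_integral
      L - 2 * pi * a0 - (a1 * 0 + b1 * 0)) {0..2 * pi}"
    unfolding L_def
    by (intro has_integral_add has_integral_diff has_integral_mult_right hasI cont const icos isin)
  then have f0: "(f has_integral 0) {0..2 * pi}"
    by (simp add: f_def[abs_def] h_def a0_def)
  have "((\<lambda>x. p x * cos x - a0 * cos x - (a1 * (cos x)\<^sup>2 + b1 * (sin x * cos x))) has_integral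
      ?I (\<lambda>x. p x * cos x) - a0 * 0 - (a1 * pi + b1 * 0)) {0..2 * pi}"
    by (intro has_integral_add has_integral_diff has_integral_mult_right hasI cont const icos icc isc
         continuous_intros)
  moreover have "(\<lambda>x. p x * cos x - a0 * cos x - (a1 * (cos x)\<^sup>2 + b1 * (sin x * cos x))) = (\<lambda>x. f x * cos x)"
    by (auto simp: f_def h_def power2_eq_square algebra_simps)
  ultimately have f1: "((\<lambda>x. f x * cos x) has_integral 0) {0..2 * pi}"
    by (simp add: a1_def)
  have "((\<lambda>x. p x * sin x - a0 * sin x - (a1 * (sin x * cos x) + b1 * (sin x)\<^sup>2)) has_integral
      ?I (\<lambda>x. p x * sin x) - a0 * 0 - (a1 * 0 + b1 * pi)) {0..2 * pi}"
    by (intro has_integral_add has_integral_diff has_integral_mult_right hasI cont const isin iss isc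
         continuous_intros)
  moreover have "(\<lambda>x. p x * sin x - a0 * sin x - (a1 * (sin x * cos x) + b1 * (sin x)\<^sup>2)) = (\<lambda>x. f x * sin x)"
    by (auto simp: f_def h_def power2_eq_square algebra_simps)
  ultimately have f2: "((\<lambda>x. f x * sin x) has_integral 0) {0..2 * pi}"
    by (simp add: b1_def)
  define E0 E1 E2 where "E0 = ?I (\<lambda>x. (f x)\<^sup>2)" and "E1 = ?I (\<lambda>x. (f' x)\<^sup>2)"
    and "E2 = ?I (\<lambda>x. (f'' x)\<^sup>2)"
  have wirt: "4 * E0 \<le> E1"
    unfolding E0_def E1_def using f0 f1 f2
    by (intro wirtinger_second df cont perf perf') (auto simp: integral_unique)
  have E0_nonneg: "0 \<le> E0" unfolding E0_def
    by (intro integral_nonneg integrable_continuous_real continuous_intros cont) auto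
  have sq: "((\<lambda>x. (f x)\<^sup>2) has_integral E0) {0..2 * pi}" "((\<lambda>x. (f' x)\<^sup>2) has_integral E1) {0..2 * pi}"
    "((\<lambda>x. (f'' x)\<^sup>2) has_integral E2) {0..2 * pi}"
    unfolding E0_def E1_def E2_def by (intro hasI continuous_intros cont cf'')+
  have f''0: "(f'' has_integral 0) {0..2 * pi}"
    by (rule FTC[OF df(2) ends[OF perf']])
  have h0: "(h has_integral 0) {0..2 * pi}"
    by (rule FTC[of "\<lambda>x. - h' x"])
      (use ends[OF perh(2)] in \<open>auto intro!: derivative_eq_intros dh\<close>)
  have ff'': "((\<lambda>x. f x * f'' x + (f' x)\<^sup>2) has_integral 0) {0..2 * pi}"
    by (rule FTC[of "\<lambda>x. f x * f' x"])
      (use ends[OF perf] ends[OF perf'] in \<open>auto intro!: derivative_eq_intros df simp: power2_eq_square\<close>)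
  \<comment> \<open>The Wronskian of \<open>h\<close> and \<open>f\<close> is a primitive because
    \<open>h\<close> solves \<open>h'' = - h\<close>. This removes the mixed terms of
    \<open>h\<close> with \<open>f\<close> and \<open>f''\<close> from the area.\<close>
  have hf: "((\<lambda>x. h x * (f x + f'' x)) has_integral 0) {0..2 * pi}"
    by (rule FTC[of "\<lambda>x. h x * f' x - h' x * f x"])
      (use ends[OF perf] ends[OF perf'] ends[OF perh(1)] ends[OF perh(2)] in
        \<open>auto intro!: derivative_eq_intros df dh simp: algebra_simps\<close>)
  have beta: "\<beta> x = f x + f'' x + a0" and p: "p x = f x + a0 + h x" for x
    by (simp_all add: f_def f''_def)
  \<comment> \<open>Here and below products are expanded so that \<open>f f''\<close> occurs only in
    \<open>f f'' + f'^2\<close>, whose integral is 0; this is the integration by parts.\<close>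
  have "((\<lambda>x. (f x)\<^sup>2 + (f'' x)\<^sup>2 + 2 * (f x * f'' x + (f' x)\<^sup>2) - 2 * (f' x)\<^sup>2
        + 2 * a0 * f x + 2 * a0 * f'' x + a0\<^sup>2) has_integral
      E0 + E2 + 2 * 0 - 2 * E1 + 2 * a0 * 0 + 2 * a0 * 0 + 2 * pi * a0\<^sup>2) {0..2 * pi}"
    by (intro has_integral_add has_integral_diff has_integral_mult_right sq ff'' f0 f''0 const)
  moreover have "(\<lambda>x. (f x)\<^sup>2 + (f'' x)\<^sup>2 + 2 * (f x * f'' x + (f' x)\<^sup>2) - 2 * (f' x)\<^sup>2
        + 2 * a0 * f x + 2 * a0 * f'' x + a0\<^sup>2) = (\<lambda>x. (\<beta> x)\<^sup>2)"
    by (auto simp: beta power2_eq_square algebra_simps)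
  ultimately have I_beta: "?I (\<lambda>x. (\<beta> x)\<^sup>2) = E0 + E2 - 2 * E1 + 2 * pi * a0\<^sup>2"
    by (simp add: integral_unique)
  have "((\<lambda>x. (f x)\<^sup>2 + (f x * f'' x + (f' x)\<^sup>2) - (f' x)\<^sup>2 + 2 * a0 * f x + a0 * f'' x
        + h x * (f x + f'' x) + a0 * h x + a0\<^sup>2) has_integral
      E0 + 0 - E1 + 2 * a0 * 0 + a0 * 0 + 0 + a0 * 0 + 2 * pi * a0\<^sup>2) {0..2 * pi}"
    by (intro has_integral_add has_integral_diff has_integral_mult_right sq ff'' f0 f''0 h0 hf const)
  moreover have "(\<lambda>x. (f x)\<^sup>2 + (f x * f'' x + (f' x)\<^sup>2) - (f' x)\<^sup>2 + 2 * a0 * f x + a0 * f'' x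
        + h x * (f x + f'' x) + a0 * h x + a0\<^sup>2) = (\<lambda>x. p x * \<beta> x)"
    by (auto simp: beta p power2_eq_square algebra_simps)
  ultimately have area: "2 * A = E0 - E1 + 2 * pi * a0\<^sup>2"
    by (simp add: A_def integral_unique)
  have "L\<^sup>2 / (4 * pi) = pi * a0\<^sup>2" by (simp add: a0_def power2_eq_square)
  then have D: "D = (E1 - E0) / 2" using area by (simp add: D_def)
  define u where "u x = f'' x + 4 * f x" for x
  have "((\<lambda>x. (f'' x)\<^sup>2 + 8 * (f x * f'' x + (f' x)\<^sup>2) - 8 * (f' x)\<^sup>2 + 16 * (f x)\<^sup>2) has_integral
      E2 + 8 * 0 - 8 * E1 + 16 * E0) {0..2 * pi}"
    by (intro has_integral_add has_integral_diff has_integral_mult_right sq ff'')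
  moreover have "(\<lambda>x. (f'' x)\<^sup>2 + 8 * (f x * f'' x + (f' x)\<^sup>2) - 8 * (f' x)\<^sup>2 + 16 * (f x)\<^sup>2)
      = (\<lambda>x. (u x)\<^sup>2)"
    by (auto simp: u_def power2_eq_square algebra_simps)
  ultimately have Iu: "?I (\<lambda>x. (u x)\<^sup>2) = E2 - 8 * E1 + 16 * E0"
    by (simp add: integral_unique)
  have R: "R = ?I (\<lambda>x. (u x)\<^sup>2) + 3 * (E1 - 4 * E0)"
    using I_beta area D Iu by (simp add: R_def)
  have cu: "continuous_on S u" for S unfolding u_def by (intro continuous_intros cont cf'')
  have u_nonneg: "0 \<le> ?I (\<lambda>x. (u x)\<^sup>2)"
    by (intro integral_nonneg integrable_continuous_real continuous_intros cu) auto
  show "D \<ge> 0" using wirt E0_nonneg D by argo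
  show "R \<ge> 0" using wirt u_nonneg R by argo
  show "\<exists>a0 a1 b1. \<forall>x. p x = a0 + a1 * cos x + b1 * sin x" if "D = 0"
  proof -
    \<comment> \<open>\<open>D = 0\<close> means \<open>E1 = E0\<close>, which together with
      \<open>4 * E0 \<le> E1\<close> and \<open>E0 \<ge> 0\<close> leaves only 0.\<close>
    have "E0 = 0" using that wirt E0_nonneg D by argo
    then have "f x = 0" for x
      using periodic_integral_square_zero[OF perf cont(3)] by (simp add: E0_def)
    then have "\<forall>x. p x = a0 + a1 * cos x + b1 * sin x" by (simp add: p h_def)
    then show ?thesis by blast
  qed
  show "\<exists>a0 a1 b1 a2 b2. \<forall>x. p x =
      a0 + a1 * cos x + b1 * sin x + a2 * cos (2 * x) + b2 * sin (2 * x)" if "R = 0"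
  proof -
    \<comment> \<open>\<open>R\<close> is a sum of two nonnegative terms, so the integral of
      \<open>u^2\<close> vanishes and \<open>f\<close> oscillates with frequency 2.\<close>
    have "?I (\<lambda>x. (u x)\<^sup>2) = 0" using that wirt u_nonneg R by argo
    moreover have "periodic u" using perf perf'' by (simp add: periodic_def u_def)
    ultimately have "u x = 0" for x using periodic_integral_square_zero cu by blast
    then have "f'' x = - 4 * f x" for x by (smt (verit) u_def)
    then have sol: "f x = f 0 * cos (2 * x) + f' 0 / 2 * sin (2 * x)" for x
      using df by (intro oscillator_solution) auto
    have "\<forall>x. p x = a0 + a1 * cos x + b1 * sin x + f 0 * cos (2 * x) + f' 0 / 2 * sin (2 * x)"
    proof
      fix x
      show "p x = a0 + a1 * cos x + b1 * sin x + f 0 * cos (2 * x) + f' 0 / 2 * sin (2 * x)"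
        using p[of x] sol[of x] h_def[of x] by linarith
    qed
    then show ?thesis by blast
  qed
qed

section \<open>Return to Legendre curves\<close>

lemma continuous_on_leg_beta:
  assumes "closed_legendre \<gamma> \<nu>" and "normal_param \<nu>"
  shows "continuous_on S (leg_beta \<gamma> \<nu>)"
proof -
  have "smooth \<gamma>" using assms(1) by (simp add: closed_legendre_def)
  then have "(vderiv ^^ 1) \<gamma> differentiable at t" for t unfolding smooth_def by blast
  then have "continuous_on S (vderiv \<gamma>)"
    by (auto intro!: continuous_at_imp_continuous_on differentiable_imp_continuous_within)
  moreover have "leg_beta \<gamma> \<nu> = (\<lambda>t. vderiv \<gamma> t $ 2 * cos t - vderiv \<gamma> t $ 1 * sin t)"
    using assms(2) by (auto simp: normal_param_def leg_beta_def J_def unit_normal_def inner_vec_def sum_2)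
  ultimately show ?thesis by (auto intro!: continuous_intros)
qed

lemma circle_beta:
  assumes "closed_legendre \<gamma> \<nu>" and "normal_param \<nu>"
    and "\<And>\<theta>. support_fun \<gamma> \<nu> \<theta> = a0 + a1 * cos \<theta> + b1 * sin \<theta>"
  shows "leg_beta \<gamma> \<nu> \<theta> = a0"
proof -
  have p: "support_fun \<gamma> \<nu> = (\<lambda>\<theta>. a0 + a1 * cos \<theta> + b1 * sin \<theta>)" using assms(3) by auto
  have "deriv (support_fun \<gamma> \<nu>) = (\<lambda>\<theta>. b1 * cos \<theta> - a1 * sin \<theta>)"
    unfolding p by (intro ext DERIV_imp_deriv) (auto intro!: derivative_eq_intros)
  moreover have "deriv (\<lambda>\<theta>. b1 * cos \<theta> - a1 * sin \<theta>) \<theta> = - a1 * cos \<theta> - b1 * sin \<theta>"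
    by (intro DERIV_imp_deriv) (auto intro!: derivative_eq_intros)
  ultimately show ?thesis
    using leg_beta_support[OF assms(1,2)] by (simp add: p)
qed

theorem proposition5p2:
  fixes \<gamma> \<nu> :: "real \<Rightarrow> real^2" and L A :: real and p \<beta> :: "real \<Rightarrow> real"
  assumes "ell_convex \<gamma> \<nu>"
    and "normal_param \<nu>"
  defines "p \<equiv> support_fun \<gamma> \<nu>"
    and "\<beta> \<equiv> leg_beta \<gamma> \<nu>"
    and "L \<equiv> alg_length \<gamma> \<nu>"
    and "A \<equiv> alg_area \<gamma> \<nu>"
  shows "(\<forall>\<tau>::real. \<tau> \<le> 8 \<longrightarrow>
            integral {0..2 * pi} (\<lambda>\<theta>. (\<beta> \<theta>)\<^sup>2) \<ge> 2 * A + \<tau> * (L\<^sup>2 / (4 * pi) - A) \<and>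
            (is_circle \<gamma> \<nu> \<longrightarrow>
              integral {0..2 * pi} (\<lambda>\<theta>. (\<beta> \<theta>)\<^sup>2) = 2 * A + \<tau> * (L\<^sup>2 / (4 * pi) - A))) \<and>
         (\<forall>\<tau>::real. \<tau> < 8 \<longrightarrow>
            integral {0..2 * pi} (\<lambda>\<theta>. (\<beta> \<theta>)\<^sup>2) = 2 * A + \<tau> * (L\<^sup>2 / (4 * pi) - A) \<longrightarrow>
            is_circle \<gamma> \<nu>) \<and>
         (integral {0..2 * pi} (\<lambda>\<theta>. (\<beta> \<theta>)\<^sup>2) = 2 * A + 8 * (L\<^sup>2 / (4 * pi) - A) \<longrightarrow>
            (\<exists>a0 a1 b1 a2 b2. \<forall>\<theta>. p \<theta> =
               a0 + a1 * cos \<theta> + b1 * sin \<theta> + a2 * cos (2 * \<theta>) + b2 * sin (2 * \<theta>)))"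
proof -
  have leg: "closed_legendre \<gamma> \<nu>" using assms(1) by (simp add: ell_convex_def)
  note np = assms(2)
  define p' where "p' t = \<gamma> t \<bullet> J (\<nu> t)" for t
  have dp: "(p has_real_derivative p' t) (at t)" for t
    unfolding p_def p'_def by (rule support_deriv[OF leg np])
  have "deriv p = p'" using DERIV_imp_deriv[OF dp] by auto
  then have dp': "(p' has_real_derivative \<beta> t - p t) (at t)" for t
    using support_deriv2[OF leg np] by (simp add: p_def \<beta>_def)
  have c\<beta>: "continuous_on UNIV \<beta>" unfolding \<beta>_def by (rule continuous_on_leg_beta[OF leg np])
  have per: "periodic p"
    using leg by (auto simp: p_def closed_legendre_def periodic_def support_fun_def)
  have L: "L = integral {0..2 * pi} p" by (simp add: L_def alg_length_def p_def)
  have A: "A = 1 / 2 * integral {0..2 * pi} (\<lambda>x. p x * \<beta> x)"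
    by (simp add: A_def alg_area_def p_def \<beta>_def leg_beta_support[OF leg np])
  define D where "D = L\<^sup>2 / (4 * pi) - A"
  define R where "R = integral {0..2 * pi} (\<lambda>x. (\<beta> x)\<^sup>2) - 2 * A - 8 * D"
  note bounds = support_function_bounds[OF dp dp' c\<beta> per, folded L A, folded D_def, folded R_def]
  have split: "integral {0..2 * pi} (\<lambda>x. (\<beta> x)\<^sup>2) = 2 * A + \<tau> * D + (R + (8 - \<tau>) * D)" for \<tau>
    by (simp add: R_def algebra_simps)
  have circle: "integral {0..2 * pi} (\<lambda>x. (\<beta> x)\<^sup>2) = 2 * A + \<tau> * D" if circ: "is_circle \<gamma> \<nu>" for \<tau>
  proof -
    obtain a0 a1 b1 where "\<forall>\<theta>. support_fun \<gamma> \<nu> \<theta> = a0 + a1 * cos \<theta> + b1 * sin \<theta>"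
      using circ unfolding is_circle_def by blast
    from circle_beta[OF leg np this[rule_format]] have \<beta>: "\<beta> = (\<lambda>x. a0)" by (auto simp: \<beta>_def)
    \<comment> \<open>With \<open>\<beta>\<close> constant, its integral gives
      \<open>L = 2 \<pi> a0\<close>, and \<open>2 A = a0 L\<close>. Hence \<open>D = 0\<close>, and
      both sides equal \<open>2 \<pi> a0^2\<close> whatever \<tau> is.\<close>
    have "(\<beta> has_integral L) {0..2 * pi}"
      unfolding \<beta>_def L_def by (rule integral_leg_beta[OF leg np])
    then have La: "L = 2 * pi * a0"
      unfolding \<beta> using has_integral_const_real[of a0 0 "2 * pi"] by (auto dest: has_integral_unique)
    have "2 * A = L * a0" by (simp add: A L \<beta>)
    then show ?thesis by (simp add: D_def \<beta> La power2_eq_square)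
  qed
  have nonneg: "0 \<le> (8 - \<tau>) * D" if "\<tau> \<le> 8" for \<tau> using bounds(1) that by simp
  have strict: "is_circle \<gamma> \<nu>"
    if "\<tau> < 8" "integral {0..2 * pi} (\<lambda>x. (\<beta> x)\<^sup>2) = 2 * A + \<tau> * D" for \<tau>
  proof -
    \<comment> \<open>Equality makes both nonnegative summands of the gap vanish, and the factor
      \<open>8 - \<tau>\<close> is positive, so \<open>D = 0\<close>.\<close>
    have "R + (8 - \<tau>) * D = 0" using split[of \<tau>] that(2) by simp
    then have "(8 - \<tau>) * D = 0" using bounds(3) nonneg[of \<tau>] that(1) by linarith
    then have "D = 0" using that(1) by simp
    then show ?thesis using bounds(2) by (simp add: is_circle_def p_def)
  qed
  show ?thesis
    unfolding D_def[symmetric]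
  proof (intro conjI allI impI)
    fix \<tau> :: real assume "\<tau> \<le> 8"
    then show "2 * A + \<tau> * D \<le> integral {0..2 * pi} (\<lambda>\<theta>. (\<beta> \<theta>)\<^sup>2)"
      using split[of \<tau>] bounds(3) nonneg[of \<tau>] by linarith
  next
    fix \<tau> :: real assume "is_circle \<gamma> \<nu>"
    then show "integral {0..2 * pi} (\<lambda>\<theta>. (\<beta> \<theta>)\<^sup>2) = 2 * A + \<tau> * D" by (rule circle)
  next
    fix \<tau> :: real
    assume "\<tau> < 8" "integral {0..2 * pi} (\<lambda>\<theta>. (\<beta> \<theta>)\<^sup>2) = 2 * A + \<tau> * D"
    then show "is_circle \<gamma> \<nu>" by (rule strict)
  next
    assume "integral {0..2 * pi} (\<lambda>\<theta>. (\<beta> \<theta>)\<^sup>2) = 2 * A + 8 * D"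
    then have "R = 0" by (simp add: R_def)
    then show "\<exists>a0 a1 b1 a2 b2. \<forall>\<theta>. p \<theta> =
        a0 + a1 * cos \<theta> + b1 * sin \<theta> + a2 * cos (2 * \<theta>) + b2 * sin (2 * \<theta>)"
      by (rule bounds(4))
  qed
qed

end
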